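(* For every $f:\mathcal X\times\mathcal Y\to\{0,1\}^k$ and every $0<\epsilon<\frac12$, $$R^{\mathrm{spt}}_\epsilon(f)\le R^{\mathrm{oot}}_\epsilon(f)\le R^{\mathrm{spt}}_\epsilon(f)+\lfloor k/2\rfloor+1,$$ and $$D^{\mathrm{spt}}(\mathrm{SplitId}_n)\in O(1),\qquad R^{\mathrm{oot}}_\epsilon(\mathrm{SplitId}_n)\in\Omega(n).$$
   Context: $\mathrm{SplitId}_n:\{0,1\}^n\times\{0,1\}^n\to\{0,1\}^n$ is given by $\mathrm{SplitId}_n(x,y)_i=x_i$ if $i\equiv0\pmod 2$ and $y_i$ otherwise. Two-party communication with private randomness $r_A,r_B$, public randomness $r$, transcript $t_\pi$ (exchanged bits, public randomness excluded), cost = maximum number of bits exchanged. One-out-of-two model with error $\epsilon$: maps $O_A(t_\pi,r,r_A,x),O_B(t_\pi,r,r_B,y)$ with values in $\{0,1\}^k\cup\{\top\}$ such that for every $(x,y)$, $\Pr[(O_A,O_B)\in\{(f(x,y),\top),(\top,f(x,y))\}]\ge1-\epsilon$. Split model with error $\epsilon$: maps $O_A,O_B$ (same arguments) with values in $\{0,1,*\}^k$ such that $\Pr[O_A\bowtie O_B=f(x,y)]\ge1-\epsilon$, where $(a\bowtie b)_i=a_i$ if $b_i=*$, $b_i$ if $a_i=*$, and $*$ otherwise. $R^{\mathrm{oot}}_\epsilon,R^{\mathrm{spt}}_\epsilon$ are the minimum costs (public and private coins allowed); $D^{\mathrm{spt}}$ is the zero-error cost. The $\Omega(n)$ is as $n\to\infty$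 for fixed $\epsilon$. *)

theory Defs
  imports "HOL-Probability.Probability" "HOL-Library.Extended_Nat" "HOL-Library.Landau_Symbols"
begin

definition words :: "nat \<Rightarrow> 'a list set" where
  "words k = {s. length s = k}"


section \<open>Two-party protocols\<close>

text \<open>
  In a protocol tree, \<open>'a\<close> and \<open>'b\<close> are the types of the private views of Alice and Bob. The owner
  of an inner node sends the bit computed from the owner's view; \<open>True\<close> leads to the
  second subtree.
\<close>

datatype ('a, 'b) ptree =
    Leaf
  | Alice "'a \<Rightarrow> bool" "('a, 'b) ptree" "('a, 'b) ptree"
  | Bob "'b \<Rightarrow> bool" "('a, 'b) ptree" "('a, 'b) ptree"

fun transcript :: "('a, 'b) ptree \<Rightarrow> 'a \<Rightarrow> 'b \<Rightarrow> bool list" where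
  "transcript Leaf a b = []"
| "transcript (Alice g t0 t1) a b = g a # transcript (if g a then t1 else t0) a b"
| "transcript (Bob g t0 t1) a b = g b # transcript (if g b then t1 else t0) a b"

text \<open>
  Random strings are coded by natural numbers, with arbitrary discrete distributions; the three
  sources are independent. The tree may depend on the public randomness, which is not part of the
  transcript.
\<close>

record ('x, 'y) protocol =
  pub :: "nat pmf"
  privA :: "nat pmf"
  privB :: "nat pmf"
  tree :: "nat \<Rightarrow> ('x \<times> nat, 'y \<times> nat) ptree"

definition coins :: "('x, 'y) protocol \<Rightarrow> (nat \<times> nat \<times> nat) pmf" where
  "coins \<pi> = pair_pmf (pub \<pi>) (pair_pmf (privA \<pi>) (privB \<pi>))"

definition run :: "('x, 'y) protocol \<Rightarrow> 'x \<Rightarrow> 'y \<Rightarrow> nat \<times> nat \<times> nat \<Rightarrow> bool list" where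
  "run \<pi> x y = (\<lambda>(r, rA, rB). transcript (tree \<pi> r) (x, rA) (y, rB))"

definition cost :: "'x set \<Rightarrow> 'y set \<Rightarrow> ('x, 'y) protocol \<Rightarrow> enat" where
  "cost X Y \<pi> = (SUP (x, y, \<omega>) \<in> X \<times> Y \<times> set_pmf (coins \<pi>). enat (length (run \<pi> x y \<omega>)))"

text \<open>An output map takes the transcript, the public coins, the player's private coins and input.\<close>

type_synonym ('z, 'o) outmap = "bool list \<Rightarrow> nat \<Rightarrow> nat \<Rightarrow> 'z \<Rightarrow> 'o"

definition outputs ::
  "('x, 'y) protocol \<Rightarrow> ('x, 'o) outmap \<Rightarrow> ('y, 'o) outmap \<Rightarrow> 'x \<Rightarrow> 'y \<Rightarrow> nat \<times> nat \<times> nat \<Rightarrow> 'o \<times> 'o"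
  where
  "outputs \<pi> OA OB x y = (\<lambda>(r, rA, rB).
     (OA (run \<pi> x y (r, rA, rB)) r rA x, OB (run \<pi> x y (r, rA, rB)) r rB y))"


section \<open>The one-out-of-two model\<close>

text \<open>The symbol \<open>\<top>\<close> is \<open>None\<close>.\<close>

definition computes_oot ::
  "real \<Rightarrow> nat \<Rightarrow> 'x set \<Rightarrow> 'y set \<Rightarrow> ('x \<Rightarrow> 'y \<Rightarrow> bool list) \<Rightarrow> ('x, 'y) protocol \<Rightarrow> bool" where
  "computes_oot \<epsilon> k X Y f \<pi> \<longleftrightarrow>
    (\<exists>(OA :: ('x, bool list option) outmap) (OB :: ('y, bool list option) outmap).
       (\<forall>t r rA x. OA t r rA x \<in> insert None (Some ` words k)) \<and>
       (\<forall>t r rB y. OB t r rB y \<in> insert None (Some ` words k)) \<and>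
       (\<forall>x\<in>X. \<forall>y\<in>Y. measure_pmf.prob (coins \<pi>)
          {\<omega>. outputs \<pi> OA OB x y \<omega> \<in> {(Some (f x y), None), (None, Some (f x y))}} \<ge> 1 - \<epsilon>))"


section \<open>The split model\<close>

text \<open>The symbol \<open>*\<close> is \<open>None\<close>.\<close>

definition bowtie_bit :: "bool option \<Rightarrow> bool option \<Rightarrow> bool option" where
  "bowtie_bit a b = (if b = None then a else if a = None then b else None)"

definition bowtie :: "bool option list \<Rightarrow> bool option list \<Rightarrow> bool option list"
  (infixl "\<bowtie>" 70) where
  "u \<bowtie> v = map2 bowtie_bit u v"

definition computes_spt ::
  "real \<Rightarrow> nat \<Rightarrow> 'x set \<Rightarrow> 'y set \<Rightarrow> ('x \<Rightarrow> 'y \<Rightarrow> bool list) \<Rightarrow> ('x, 'y) protocol \<Rightarrow> bool" where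
  "computes_spt \<epsilon> k X Y f \<pi> \<longleftrightarrow>
    (\<exists>(OA :: ('x, bool option list) outmap) (OB :: ('y, bool option list) outmap).
       (\<forall>t r rA x. OA t r rA x \<in> words k) \<and>
       (\<forall>t r rB y. OB t r rB y \<in> words k) \<and>
       (\<forall>x\<in>X. \<forall>y\<in>Y. measure_pmf.prob (coins \<pi>)
          {\<omega>. case outputs \<pi> OA OB x y \<omega> of (u, v) \<Rightarrow> u \<bowtie> v = map Some (f x y)} \<ge> 1 - \<epsilon>))"


section \<open>Complexity measures\<close>

text \<open>
  The value is \<open>\<infinity>\<close> iff no protocol has finite cost; otherwise the infimum is a minimum, since
  \<open>enat\<close> is well-ordered. For finite \<open>X\<close> it is never \<open>\<infinity>\<close>: see \<open>R_oot_finite\<close> and \<open>R_spt_finite\<close>.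
\<close>

definition R_oot :: "real \<Rightarrow> nat \<Rightarrow> 'x set \<Rightarrow> 'y set \<Rightarrow> ('x \<Rightarrow> 'y \<Rightarrow> bool list) \<Rightarrow> enat" where
  "R_oot \<epsilon> k X Y f = (INF \<pi> \<in> {\<pi>. computes_oot \<epsilon> k X Y f \<pi>}. cost X Y \<pi>)"

definition R_spt :: "real \<Rightarrow> nat \<Rightarrow> 'x set \<Rightarrow> 'y set \<Rightarrow> ('x \<Rightarrow> 'y \<Rightarrow> bool list) \<Rightarrow> enat" where
  "R_spt \<epsilon> k X Y f = (INF \<pi> \<in> {\<pi>. computes_spt \<epsilon> k X Y f \<pi>}. cost X Y \<pi>)"

text \<open>Zero-error cost; by \<open>D_spt_deterministic\<close> below, coins do not help here.\<close>

definition D_spt :: "nat \<Rightarrow> 'x set \<Rightarrow> 'y set \<Rightarrow> ('x \<Rightarrow> 'y \<Rightarrow> bool list) \<Rightarrow> enat" where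
  "D_spt k X Y f = R_spt 0 k X Y f"

text \<open>Positions are numbered \<open>1, \<dots>, n\<close>, while list indices start at \<open>0\<close>.\<close>

definition SplitId :: "nat \<Rightarrow> bool list \<Rightarrow> bool list \<Rightarrow> bool list" where
  "SplitId n x y = map (\<lambda>i. if i mod 2 = 0 then x ! (i - 1) else y ! (i - 1)) [1..<n+1]"


section \<open>Sanity checks\<close>

definition deterministic :: "('x, 'y) protocol \<Rightarrow> bool" where
  "deterministic \<pi> \<longleftrightarrow>
     pub \<pi> = return_pmf 0 \<and> privA \<pi> = return_pmf 0 \<and> privB \<pi> = return_pmf 0"

fun fix_coins :: "nat \<Rightarrow> nat \<Rightarrow> ('x \<times> nat, 'y \<times> nat) ptree \<Rightarrow> ('x \<times> nat, 'y \<times> nat) ptree" where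
  "fix_coins rA rB Leaf = Leaf"
| "fix_coins rA rB (Alice g t0 t1) =
     Alice (\<lambda>(x, _). g (x, rA)) (fix_coins rA rB t0) (fix_coins rA rB t1)"
| "fix_coins rA rB (Bob g t0 t1) =
     Bob (\<lambda>(y, _). g (y, rB)) (fix_coins rA rB t0) (fix_coins rA rB t1)"

lemma transcript_fix_coins:
  "transcript (fix_coins rA rB T) (x, a) (y, b) = transcript T (x, rA) (y, rB)"
  by (induction T) auto

lemma D_spt_deterministic:
  fixes X :: "'x set" and Y :: "'y set"
  shows "D_spt k X Y f = (INF \<pi> \<in> {\<pi>. deterministic \<pi> \<and> computes_spt 0 k X Y f \<pi>}. cost X Y \<pi>)"
proof (rule antisym)
  show "D_spt k X Y f \<le> (INF \<pi> \<in> {\<pi>. deterministic \<pi> \<and> computes_spt 0 k X Y f \<pi>}. cost X Y \<pi>)"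
    unfolding D_spt_def R_spt_def by (rule INF_superset_mono) auto
  show "(INF \<pi> \<in> {\<pi>. deterministic \<pi> \<and> computes_spt 0 k X Y f \<pi>}. cost X Y \<pi>) \<le> D_spt k X Y f"
    unfolding D_spt_def R_spt_def
  proof (rule INF_mono)
    fix \<pi> :: "('x, 'y) protocol" assume "\<pi> \<in> {\<pi>. computes_spt 0 k X Y f \<pi>}"
    then obtain OA :: "('x, bool option list) outmap" and OB :: "('y, bool option list) outmap"
      where OA: "\<And>t r rA x. OA t r rA x \<in> words k" and OB: "\<And>t r rB y. OB t r rB y \<in> words k"
        and succ: "\<And>x y. x \<in> X \<Longrightarrow> y \<in> Y \<Longrightarrow> measure_pmf.prob (coins \<pi>)
          {\<omega>. case outputs \<pi> OA OB x y \<omega> of (u, v) \<Rightarrow> u \<bowtie> v = map Some (f x y)} \<ge> 1 - 0"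
      unfolding computes_spt_def mem_Collect_eq by blast
    obtain r rA rB where w: "(r, rA, rB) \<in> set_pmf (coins \<pi>)"
      using set_pmf_not_empty[of "coins \<pi>"] by fastforce
    have good: "case outputs \<pi> OA OB x y (r, rA, rB) of (u, v) \<Rightarrow> u \<bowtie> v = map Some (f x y)"
      if "x \<in> X" "y \<in> Y" for x y
    proof -
      have "measure_pmf.prob (coins \<pi>)
          {\<omega>. case outputs \<pi> OA OB x y \<omega> of (u, v) \<Rightarrow> u \<bowtie> v = map Some (f x y)} = 1"
        using succ[OF that] measure_pmf.prob_le_1[of "coins \<pi>"] by (simp add: antisym)
      then have "AE \<omega> in measure_pmf (coins \<pi>).
          case outputs \<pi> OA OB x y \<omega> of (u, v) \<Rightarrow> u \<bowtie> v = map Some (f x y)"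
        using measure_pmf.AE_prob_1 by force
      with w show ?thesis by (auto simp: AE_measure_pmf_iff)
    qed
    define \<rho> :: "('x, 'y) protocol" where
      "\<rho> = \<lparr>pub = return_pmf 0, privA = return_pmf 0, privB = return_pmf 0,
        tree = (\<lambda>_. fix_coins rA rB (tree \<pi> r))\<rparr>"
    have coins: "coins \<rho> = return_pmf (0, 0, 0)"
      by (simp add: \<rho>_def coins_def pair_return_pmf1)
    have run: "run \<rho> x y (0, 0, 0) = run \<pi> x y (r, rA, rB)" for x y
      by (simp add: \<rho>_def run_def transcript_fix_coins)
    have "cost X Y \<rho> \<le> cost X Y \<pi>"
      unfolding cost_def
    proof (rule SUP_mono)
      fix z assume "z \<in> X \<times> Y \<times> set_pmf (coins \<rho>)"
      then obtain x y where z: "z = (x, y, 0, 0, 0)" "x \<in> X" "y \<in> Y" by (auto simp: coins)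
      show "\<exists>z'\<in>X \<times> Y \<times> set_pmf (coins \<pi>).
          (case z of (x, y, \<omega>) \<Rightarrow> enat (length (run \<rho> x y \<omega>)))
          \<le> (case z' of (x, y, \<omega>) \<Rightarrow> enat (length (run \<pi> x y \<omega>)))"
        using z w by (intro bexI[of _ "(x, y, r, rA, rB)"]) (auto simp: run)
    qed
    moreover have "computes_spt 0 k X Y f \<rho>"
      unfolding computes_spt_def
    proof (intro exI conjI)
      let ?OA = "\<lambda>t (_ :: nat) (_ :: nat) x. OA t r rA x"
      let ?OB = "\<lambda>t (_ :: nat) (_ :: nat) y. OB t r rB y"
      show "\<forall>t r rA x. ?OA t r rA x \<in> words k" "\<forall>t r rB y. ?OB t r rB y \<in> words k"
        using OA OB by auto
      show "\<forall>x\<in>X. \<forall>y\<in>Y. measure_pmf.prob (coins \<rho>)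
          {\<omega>. case outputs \<rho> ?OA ?OB x y \<omega> of (u, v) \<Rightarrow> u \<bowtie> v = map Some (f x y)} \<ge> 1 - 0"
        using good by (auto simp: coins outputs_def run measure_return_pmf indicator_def)
    qed
    moreover have "deterministic \<rho>"
      by (simp add: deterministic_def \<rho>_def)
    ultimately show "\<exists>\<rho>\<in>{\<pi>. deterministic \<pi> \<and> computes_spt 0 k X Y f \<pi>}. cost X Y \<rho> \<le> cost X Y \<pi>"
      by blast
  qed
qed

fun announce :: "'x list \<Rightarrow> ('x \<times> nat, 'y \<times> nat) ptree" where
  "announce [] = Leaf"
| "announce (z # zs) = Alice (\<lambda>(x, _). x = z) (announce zs) Leaf"

lemma length_announce: "length (transcript (announce zs) a b) \<le> length zs"
  by (induction zs) auto

lemma announce_coins: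
  "transcript (announce zs) (x, i) b = transcript (announce zs) (x, j) c"
  by (induction zs) auto

lemma announce_inj:
  assumes "x \<in> set zs" "transcript (announce zs) (x, i) b = transcript (announce zs) (x', j) c"
  shows "x = x'"
  using assms by (induction zs) (auto split: if_splits)

lemma learn_input:
  fixes X :: "'x set" and Y :: "'y set"
  assumes "finite X"
  obtains \<pi> :: "('x, 'y) protocol" and dec
  where "cost X Y \<pi> < \<infinity>" "\<And>x y \<omega>. x \<in> X \<Longrightarrow> dec (run \<pi> x y \<omega>) = x"
proof -
  obtain zs where zs: "set zs = X" using finite_list[OF assms] by blast
  define \<pi> :: "('x, 'y) protocol" where
    "\<pi> = \<lparr>pub = return_pmf 0, privA = return_pmf 0, privB = return_pmf 0, tree = (\<lambda>_. announce zs)\<rparr>"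
  define T where "T x = transcript (announce zs) (x, 0 :: nat) (undefined :: 'y \<times> nat)" for x
  have run: "run \<pi> x y \<omega> = T x" for x y \<omega>
    by (cases \<omega>) (simp add: run_def \<pi>_def T_def announce_coins[of zs x _ _ 0 undefined])
  have inj: "inj_on T X"
    unfolding T_def zs[symmetric] by (rule inj_onI) (rule announce_inj)
  have "cost X Y \<pi> \<le> enat (length zs)"
    unfolding cost_def by (rule SUP_least) (auto simp: run T_def length_announce)
  also have "\<dots> < \<infinity>" by simp
  finally show thesis
    using inj by (intro that[of \<pi> "inv_into X T"]) (auto simp: run)
qed

lemma R_oot_finite:
  fixes X :: "'x set" and Y :: "'y set"
  assumes "finite X" "\<epsilon> \<ge> 0" and f: "\<And>x y. x \<in> X \<Longrightarrow> y \<in> Y \<Longrightarrow> f x y \<in> words k"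
  shows "R_oot \<epsilon> k X Y f < \<infinity>"
proof -
  obtain \<pi> :: "('x, 'y) protocol" and dec
    where \<pi>: "cost X Y \<pi> < \<infinity>" and dec: "\<And>x y \<omega>. x \<in> X \<Longrightarrow> dec (run \<pi> x y \<omega>) = x"
    by (rule learn_input[OF assms(1)]) blast
  define OB where "OB t (r :: nat) (rB :: nat) y =
    (if dec t \<in> X \<and> y \<in> Y then Some (f (dec t) y) else None)" for t y r rB
  have "computes_oot \<epsilon> k X Y f \<pi>"
    unfolding computes_oot_def
  proof (intro exI conjI)
    let ?OA = "\<lambda>(_ :: bool list) (_ :: nat) (_ :: nat) (_ :: 'x). None :: bool list option"
    show "\<forall>t r rA x. ?OA t r rA x \<in> insert None (Some ` words k)" by simp
    show "\<forall>t r rB y. OB t r rB y \<in> insert None (Some ` words k)" using f by (auto simp: OB_def)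
    show "\<forall>x\<in>X. \<forall>y\<in>Y. measure_pmf.prob (coins \<pi>)
        {\<omega>. outputs \<pi> ?OA OB x y \<omega> \<in> {(Some (f x y), None), (None, Some (f x y))}} \<ge> 1 - \<epsilon>"
      using assms(2) by (auto simp: outputs_def OB_def dec case_prod_unfold)
  qed
  then have "R_oot \<epsilon> k X Y f \<le> cost X Y \<pi>"
    unfolding R_oot_def by (intro INF_lower) auto
  then show ?thesis using \<pi> by (rule le_less_trans)
qed

lemma R_spt_finite:
  fixes X :: "'x set" and Y :: "'y set"
  assumes "finite X" "\<epsilon> \<ge> 0" and f: "\<And>x y. x \<in> X \<Longrightarrow> y \<in> Y \<Longrightarrow> f x y \<in> words k"
  shows "R_spt \<epsilon> k X Y f < \<infinity>"
proof -
  obtain \<pi> :: "('x, 'y) protocol" and dec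
    where \<pi>: "cost X Y \<pi> < \<infinity>" and dec: "\<And>x y \<omega>. x \<in> X \<Longrightarrow> dec (run \<pi> x y \<omega>) = x"
    by (rule learn_input[OF assms(1)]) blast
  have none: "replicate k None \<bowtie> map Some s = map Some s" if "s \<in> words k" for s
    using that by (auto simp: words_def bowtie_def bowtie_bit_def intro!: nth_equalityI)
  define OB where "OB t (r :: nat) (rB :: nat) y =
    (if dec t \<in> X \<and> y \<in> Y then map Some (f (dec t) y) else replicate k None)" for t y r rB
  have "computes_spt \<epsilon> k X Y f \<pi>"
    unfolding computes_spt_def
  proof (intro exI conjI)
    let ?OA = "\<lambda>(_ :: bool list) (_ :: nat) (_ :: nat) (_ :: 'x). replicate k (None :: bool option)"
    show "\<forall>t r rA x. ?OA t r rA x \<in> words k" by (simp add: words_def)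
    show "\<forall>t r rB y. OB t r rB y \<in> words k" using f by (auto simp: OB_def words_def)
    show "\<forall>x\<in>X. \<forall>y\<in>Y. measure_pmf.prob (coins \<pi>)
        {\<omega>. case outputs \<pi> ?OA OB x y \<omega> of (u, v) \<Rightarrow> u \<bowtie> v = map Some (f x y)} \<ge> 1 - \<epsilon>"
      using assms(2) by (auto simp: outputs_def OB_def dec case_prod_unfold none f)
  qed
  then have "R_spt \<epsilon> k X Y f \<le> cost X Y \<pi>"
    unfolding R_spt_def by (intro INF_lower) auto
  then show ?thesis using \<pi> by (rule le_less_trans)
qed

lemma finite_bool_words: "finite (words n :: bool list set)"
  using finite_lists_length_eq[of "UNIV :: bool set" n] by (simp add: words_def)

lemma SplitId_words: "SplitId n x y \<in> words n"
  by (simp add: SplitId_def words_def)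

end

theory Submission
  imports Defs
begin

text \<open>
  An answer in the one-out-of-two model is a split answer in which one player leaves every position
  blank. Conversely, in a correct split answer the two players own complementary sets of positions,
  so one of them owns at most \<open>\<lfloor>k/2\<rfloor>\<close> of the bits. One extra bit announces who this is, and the
  owner sends the bits in order of position; the other player knows the positions, which are his
  own blanks.

  \<open>SplitId\<close> needs no communication in the split model. For the lower bound in the one-out-of-two
  model fix all coins: Alice's answer is determined by \<open>x\<close> and the transcript, and each possible
  answer is correct for at most \<open>2\<^bsup>\<lfloor>n/2\<rfloor>\<^esup>\<close> of the inputs \<open>y\<close>. With at most \<open>2\<^bsup>c+1\<^esup>\<close> transcripts
  only about \<open>2\<^bsup>n + c + n/2\<^esup>\<close> of the \<open>4\<^bsup>n\<^esup>\<close> input pairs are answered correctly by Alice, and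
  likewise for Bob. Averaging over the coins, half of all pairs are answered correctly, so
  \<open>c \<ge> n/2 - O(1)\<close>.
\<close>

section \<open>From one-out-of-two to split\<close>

lemma bowtie_blank_left:
  assumes "length v = k"
  shows "replicate k None \<bowtie> v = v"
  using assms by (auto simp: bowtie_def bowtie_bit_def intro!: nth_equalityI)

lemma bowtie_commute: "u \<bowtie> v = v \<bowtie> u"
  unfolding bowtie_def
  by (induction u v rule: list_induct2') (auto simp: bowtie_bit_def)

text \<open>The protocol stays the same; only the outputs are translated. A silent player returns
  the all-blank word, which is neutral for \<open>\<bowtie>\<close> on words of length
  \<open>k\<close>.\<close>

lemma computes_oot_imp_spt:
  assumes f: "\<And>x y. x \<in> X \<Longrightarrow> y \<in> Y \<Longrightarrow> f x y \<in> words k"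
    and "computes_oot \<epsilon> k X Y f \<pi>"
  shows "computes_spt \<epsilon> k X Y f \<pi>"
proof -
  obtain OA OB where OA: "\<And>t r rA x. OA t r rA x \<in> insert None (Some ` words k)"
    and OB: "\<And>t r rB y. OB t r rB y \<in> insert None (Some ` words k)"
    and succ: "\<And>x y. x \<in> X \<Longrightarrow> y \<in> Y \<Longrightarrow> measure_pmf.prob (coins \<pi>)
        {\<omega>. outputs \<pi> OA OB x y \<omega> \<in> {(Some (f x y), None), (None, Some (f x y))}} \<ge> 1 - \<epsilon>"
    using assms(2) unfolding computes_oot_def by blast
  define h :: "bool list option \<Rightarrow> bool option list" where
    "h = case_option (replicate k None) (map Some)"
  have h_words: "h z \<in> words k" if "z \<in> insert None (Some ` words k)" for z
    using that by (auto simp: h_def words_def)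
  show ?thesis
    unfolding computes_spt_def
  proof (intro exI conjI ballI)
    let ?OA = "\<lambda>t r rA x. h (OA t r rA x)" and ?OB = "\<lambda>t r rB y. h (OB t r rB y)"
    show "\<forall>t r rA x. ?OA t r rA x \<in> words k" "\<forall>t r rB y. ?OB t r rB y \<in> words k"
      using h_words OA OB by auto
    fix x y assume xy: "x \<in> X" "y \<in> Y"
    have len: "length (map Some (f x y)) = k" using f[OF xy] by (simp add: words_def)
    have "{\<omega>. outputs \<pi> OA OB x y \<omega> \<in> {(Some (f x y), None), (None, Some (f x y))}}
       \<subseteq> {\<omega>. case outputs \<pi> ?OA ?OB x y \<omega> of (u, v) \<Rightarrow> u \<bowtie> v = map Some (f x y)}"
      using bowtie_blank_left[OF len] bowtie_commute[of "map Some (f x y)"]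
      by (auto simp: outputs_def h_def)
    from measure_pmf.finite_measure_mono[OF this, of "coins \<pi>"] succ[OF xy]
    show "measure_pmf.prob (coins \<pi>)
        {\<omega>. case outputs \<pi> ?OA ?OB x y \<omega> of (u, v) \<Rightarrow> u \<bowtie> v = map Some (f x y)} \<ge> 1 - \<epsilon>"
      by simp
  qed
qed

lemma R_spt_le_R_oot:
  assumes "\<And>x y. x \<in> X \<Longrightarrow> y \<in> Y \<Longrightarrow> f x y \<in> words k"
  shows "R_spt \<epsilon> k X Y f \<le> R_oot \<epsilon> k X Y f"
  unfolding R_spt_def R_oot_def
  by (rule INF_superset_mono) (use computes_oot_imp_spt[OF assms] in auto)


section \<open>From split to one-out-of-two\<close>

text \<open>Sequential composition: the second tree may depend on the transcript of the first, which
  both players have seen.\<close>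

fun graft :: "('a, 'b) ptree \<Rightarrow> (bool list \<Rightarrow> ('a, 'b) ptree) \<Rightarrow> ('a, 'b) ptree" where
  "graft Leaf F = F []"
| "graft (Alice g t0 t1) F =
     Alice g (graft t0 (\<lambda>t. F (False # t))) (graft t1 (\<lambda>t. F (True # t)))"
| "graft (Bob g t0 t1) F =
     Bob g (graft t0 (\<lambda>t. F (False # t))) (graft t1 (\<lambda>t. F (True # t)))"

lemma transcript_graft:
  "transcript (graft T F) a b = transcript T a b @ transcript (F (transcript T a b)) a b"
  by (induction T arbitrary: F) auto

fun sayA :: "nat \<Rightarrow> ('a \<Rightarrow> bool list) \<Rightarrow> ('a, 'b) ptree" where
  "sayA 0 g = Leaf"
| "sayA (Suc m) g = (let T = sayA m (\<lambda>a. tl (g a)) in Alice (\<lambda>a. hd (g a)) T T)"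

fun sayB :: "nat \<Rightarrow> ('b \<Rightarrow> bool list) \<Rightarrow> ('a, 'b) ptree" where
  "sayB 0 g = Leaf"
| "sayB (Suc m) g = (let T = sayB m (\<lambda>b. tl (g b)) in Bob (\<lambda>b. hd (g b)) T T)"

lemma transcript_sayA: "length (g a) = m \<Longrightarrow> transcript (sayA m g) a b = g a"
  by (induction m arbitrary: g) (auto simp: Let_def length_Suc_conv)

lemma transcript_sayB: "length (g b) = m \<Longrightarrow> transcript (sayB m g) a b = g b"
  by (induction m arbitrary: g) (auto simp: Let_def length_Suc_conv)

section \<open>Transmitting the bits owned by one player\<close>

definition entries :: "'c option list \<Rightarrow> 'c list" where
  "entries u = map the (filter (\<lambda>z. z \<noteq> None) u)"

fun fill :: "bool option list \<Rightarrow> bool list \<Rightarrow> bool list" where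
  "fill [] ms = []"
| "fill (Some b # v) ms = b # fill v ms"
| "fill (None # v) ms = (ms \<noteq> [] \<and> hd ms) # fill v (tl ms)"

lemma length_fill [simp]: "length (fill v ms) = length v"
  by (induction v ms rule: fill.induct) auto

text \<open>At each position of a correct split answer exactly one player has a bit, so the blanks
  of \<open>v\<close> match the entries of \<open>u\<close> in order and \<open>pad\<close> is never
  reached.\<close>

lemma fill_entries:
  assumes "length u = length v" "u \<bowtie> v = map Some s"
  shows "fill v (entries u @ pad) = s"
  using assms unfolding bowtie_def
  by (induction u v arbitrary: s rule: list_induct2)
    (auto simp: entries_def bowtie_bit_def Cons_eq_map_conv split: if_splits)

lemma length_entries_add:
  assumes "length u = length v" "u \<bowtie> v = map Some s"
  shows "length (entries u) + length (entries v) = length v"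
  using assms unfolding bowtie_def
  by (induction u v arbitrary: s rule: list_induct2)
    (auto simp: entries_def bowtie_bit_def Cons_eq_map_conv split: if_splits)

text \<open>Padding and truncation fix the length at \<open>m\<close>, even on failing runs where a
  player may own more than \<open>m\<close> bits.\<close>

definition message :: "nat \<Rightarrow> bool option list \<Rightarrow> bool list" where
  "message m u = take m (entries u @ replicate m False)"

lemma length_message [simp]: "length (message m u) = m"
  by (simp add: message_def)

lemma fill_message:
  assumes "length u = length v" "u \<bowtie> v = map Some s" "length (entries u) \<le> m"
  shows "fill v (message m u) = s"
  using assms fill_entries[OF assms(1,2)] by (simp add: message_def)

text \<open>
  The tail has the same length on every path, so the original transcript can be recovered from the
  extended one by dropping a fixed number of bits.
\<close>

definition tail ::
  "nat \<Rightarrow> ('a \<Rightarrow> bool option list) \<Rightarrow> ('b \<Rightarrow> bool option list) \<Rightarrow> ('a, 'b) ptree" where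
  "tail m u v = Alice (\<lambda>a. length (entries (u a)) \<le> m)
     (sayB m (\<lambda>b. message m (v b))) (sayA m (\<lambda>a. message m (u a)))"

lemma transcript_tail:
  "transcript (tail m u v) a b =
    (if length (entries (u a)) \<le> m then True # message m (u a) else False # message m (v b))"
  by (simp add: tail_def transcript_sayA transcript_sayB)

lemma oot_from_spt:
  fixes \<pi> :: "('x, 'y) protocol"
  assumes "computes_spt \<epsilon> k X Y f \<pi>"
  obtains \<rho> :: "('x, 'y) protocol"
  where "computes_oot \<epsilon> k X Y f \<rho>" "cost X Y \<rho> \<le> cost X Y \<pi> + enat (k div 2 + 1)"
proof -
  obtain OA OB where OA: "\<And>t r rA x. OA t r rA x \<in> words k"
    and OB: "\<And>t r rB y. OB t r rB y \<in> words k"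
    and succ: "\<And>x y. x \<in> X \<Longrightarrow> y \<in> Y \<Longrightarrow> measure_pmf.prob (coins \<pi>)
          {\<omega>. case outputs \<pi> OA OB x y \<omega> of (u, v) \<Rightarrow> u \<bowtie> v = map Some (f x y)} \<ge> 1 - \<epsilon>"
    using assms unfolding computes_spt_def by blast
  define m where "m = k div 2"
  define \<rho> where "\<rho> = \<pi>\<lparr>tree := \<lambda>r. graft (tree \<pi> r)
    (\<lambda>t. tail m (\<lambda>(x, rA). OA t r rA x) (\<lambda>(y, rB). OB t r rB y))\<rparr>"
  \<comment> \<open>The tail always has \<open>Suc m\<close> bits, a flag and a message, so it can
    be split off from the end.\<close>
  define cut :: "bool list \<Rightarrow> bool list" where "cut s = take (length s - Suc m) s" for s
  define ext :: "bool list \<Rightarrow> bool list" where "ext s = drop (length s - Suc m) s" for s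
  \<comment> \<open>Flag \<open>True\<close> means that Alice sent her bits, so Bob is the one who
    answers; \<open>False\<close> means the reverse.\<close>
  define OA' where "OA' s r rA x =
    (if hd (ext s) then None else Some (fill (OA (cut s) r rA x) (tl (ext s))))" for s r rA x
  define OB' where "OB' s r rB y =
    (if hd (ext s) then Some (fill (OB (cut s) r rB y) (tl (ext s))) else None)" for s r rB y
  have coins: "coins \<rho> = coins \<pi>"
    by (simp add: \<rho>_def coins_def)
  have run: "run \<rho> x y (r, rA, rB) = run \<pi> x y (r, rA, rB) @
      (let t = run \<pi> x y (r, rA, rB); u = OA t r rA x; v = OB t r rB y in
       if length (entries u) \<le> m then True # message m u else False # message m v)"
    for x y r rA rB
    by (simp add: \<rho>_def run_def transcript_graft transcript_tail Let_def)
  have good: "outputs \<rho> OA' OB' x y (r, rA, rB) \<in> {(Some s, None), (None, Some s)}"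
    if ok: "case outputs \<pi> OA OB x y (r, rA, rB) of (u, v) \<Rightarrow> u \<bowtie> v = map Some s"
    for x y r rA rB s
  proof -
    define t where "t = run \<pi> x y (r, rA, rB)"
    define u where "u = OA t r rA x"
    define v where "v = OB t r rB y"
    have len: "length u = k" "length v = k"
      using OA OB by (auto simp: u_def v_def words_def)
    have eq: "u \<bowtie> v = map Some s" using ok by (simp add: outputs_def u_def v_def t_def)
    show ?thesis
    proof (cases "length (entries u) \<le> m")
      case True
      then have s: "run \<rho> x y (r, rA, rB) = t @ True # message m u"
        unfolding run Let_def t_def u_def by simp
      show ?thesis
        using fill_message[OF _ eq True] len
        by (simp add: outputs_def s OA'_def OB'_def cut_def ext_def flip: v_def)
    next
      case False
      then have s: "run \<rho> x y (r, rA, rB) = t @ False # message m v"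
        unfolding run Let_def t_def u_def v_def by simp
      \<comment> \<open>Alice owns more than \<open>k div 2\<close> of the \<open>k\<close> bits, so
        at most \<open>k div 2\<close> remain for Bob.\<close>
      have "length (entries v) \<le> m"
        using length_entries_add[OF _ eq] len False by (simp add: m_def)
      then have "fill u (message m v) = s"
        using len eq bowtie_commute[of u v] by (intro fill_message) auto
      then show ?thesis
        by (simp add: outputs_def s OA'_def OB'_def cut_def ext_def flip: u_def)
    qed
  qed
  have "computes_oot \<epsilon> k X Y f \<rho>"
    unfolding computes_oot_def
  proof (intro exI conjI ballI)
    show "\<forall>t r rA x. OA' t r rA x \<in> insert None (Some ` words k)"
      "\<forall>t r rB y. OB' t r rB y \<in> insert None (Some ` words k)"
      using OA OB by (auto simp: OA'_def OB'_def words_def)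
    fix x y assume xy: "x \<in> X" "y \<in> Y"
    have "{\<omega>. case outputs \<pi> OA OB x y \<omega> of (u, v) \<Rightarrow> u \<bowtie> v = map Some (f x y)}
      \<subseteq> {\<omega>. outputs \<rho> OA' OB' x y \<omega> \<in> {(Some (f x y), None), (None, Some (f x y))}}"
    proof (intro Collect_mono impI)
      fix \<omega> assume ok: "case outputs \<pi> OA OB x y \<omega> of (u, v) \<Rightarrow> u \<bowtie> v = map Some (f x y)"
      obtain r rA rB where \<omega>: "\<omega> = (r, rA, rB)" by (cases \<omega>)
      show "outputs \<rho> OA' OB' x y \<omega> \<in> {(Some (f x y), None), (None, Some (f x y))}"
        unfolding \<omega> by (rule good) (rule ok[unfolded \<omega>])
    qed
    from measure_pmf.finite_measure_mono[OF this, of "coins \<pi>"] succ[OF xy]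
    show "measure_pmf.prob (coins \<rho>)
        {\<omega>. outputs \<rho> OA' OB' x y \<omega> \<in> {(Some (f x y), None), (None, Some (f x y))}} \<ge> 1 - \<epsilon>"
      by (simp add: coins)
  qed
  moreover have "cost X Y \<rho> \<le> cost X Y \<pi> + enat (k div 2 + 1)"
    unfolding cost_def[of X Y \<rho>]
  proof (rule SUP_least, clarify)
    fix x y r rA rB
    assume mem: "x \<in> X" "y \<in> Y" "(r, rA, rB) \<in> set_pmf (coins \<rho>)"
    have "enat (length (run \<pi> x y (r, rA, rB))) \<le> cost X Y \<pi>"
      unfolding cost_def
      by (rule SUP_upper2[of "(x, y, r, rA, rB)"]) (use mem in \<open>auto simp: coins\<close>)
    moreover have "length (run \<rho> x y (r, rA, rB)) = length (run \<pi> x y (r, rA, rB)) + (k div 2 + 1)"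
      by (simp add: run Let_def m_def)
    ultimately show "enat (length (run \<rho> x y (r, rA, rB))) \<le> cost X Y \<pi> + enat (k div 2 + 1)"
      by (metis add_right_mono plus_enat_simps(1))
  qed
  ultimately show thesis by (rule that)
qed

text \<open>A finite infimum rules out the empty family, whose infimum is
  \<open>\<infinity>\<close>; well-ordering of \<open>enat\<close> then provides a
  minimiser.\<close>

lemma INF_enat_attained:
  fixes g :: "'c \<Rightarrow> enat"
  assumes "(INF a\<in>A. g a) = enat c"
  obtains a where "a \<in> A" "g a = enat c"
proof -
  have ne: "A \<noteq> {}" using assms by (auto simp: Inf_enat_def)
  have "(LEAST z. z \<in> g ` A) \<in> g ` A"
    using LeastI_ex[of "\<lambda>z. z \<in> g ` A"] ne by blast
  moreover have "(LEAST z. z \<in> g ` A) = enat c"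
    using assms ne by (simp add: Inf_enat_def)
  ultimately obtain a where "a \<in> A" "enat c = g a" by (metis imageE)
  then show thesis using that[of a] by simp
qed

lemma R_oot_le_R_spt:
  fixes X :: "'x set" and Y :: "'y set"
  shows "R_oot \<epsilon> k X Y f \<le> R_spt \<epsilon> k X Y f + enat (k div 2 + 1)"
proof (cases "R_spt \<epsilon> k X Y f")
  case (enat c)
  then obtain \<pi> :: "('x, 'y) protocol"
    where \<pi>: "computes_spt \<epsilon> k X Y f \<pi>" and c: "cost X Y \<pi> = enat c"
    unfolding R_spt_def by (elim INF_enat_attained) simp
  obtain \<rho> :: "('x, 'y) protocol"
    where "computes_oot \<epsilon> k X Y f \<rho>" "cost X Y \<rho> \<le> cost X Y \<pi> + enat (k div 2 + 1)"
    using oot_from_spt[OF \<pi>] .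
  then show ?thesis
    unfolding enat c unfolding R_oot_def by (intro INF_lower2) auto
qed simp


section \<open>The split identity\<close>

lemma D_spt_SplitId: "D_spt n (words n) (words n) (SplitId n) = 0"
proof -
  define \<pi> :: "(bool list, bool list) protocol" where
    "\<pi> = \<lparr>pub = return_pmf 0, privA = return_pmf 0, privB = return_pmf 0, tree = (\<lambda>_. Leaf)\<rparr>"
  define OA :: "(bool list, bool option list) outmap" where
    "OA t r rA x = map (\<lambda>i. if i mod 2 = 0 then Some (x ! (i - 1)) else None) [1..<n+1]" for t r rA x
  define OB :: "(bool list, bool option list) outmap" where
    "OB t r rB y = map (\<lambda>i. if i mod 2 = 0 then None else Some (y ! (i - 1))) [1..<n+1]" for t r rB y
  have "computes_spt 0 n (words n) (words n) (SplitId n) \<pi>"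
    unfolding computes_spt_def
  proof (intro exI conjI ballI)
    show "\<forall>t r rA x. OA t r rA x \<in> words n" "\<forall>t r rB y. OB t r rB y \<in> words n"
      by (auto simp: OA_def OB_def words_def)
    fix x y
    have "OA t r rA x \<bowtie> OB t r rB y = map Some (SplitId n x y)" for t r rA rB
      by (rule nth_equalityI)
        (auto simp: OA_def OB_def bowtie_def bowtie_bit_def SplitId_def simp del: upt_Suc)
    then show "measure_pmf.prob (coins \<pi>)
        {\<omega>. case outputs \<pi> OA OB x y \<omega> of (u, v) \<Rightarrow> u \<bowtie> v = map Some (SplitId n x y)} \<ge> 1 - 0"
      by (simp add: outputs_def case_prod_unfold)
  qed
  then have "D_spt n (words n) (words n) (SplitId n) \<le> cost (words n) (words n) \<pi>"
    unfolding D_spt_def R_spt_def by (intro INF_lower) auto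
  also have "\<dots> \<le> 0"
    unfolding cost_def by (rule SUP_least) (auto simp: \<pi>_def run_def zero_enat_def)
  finally show ?thesis by simp
qed

lemma card_words: "card (words n :: bool list set) = 2 ^ n"
  using card_lists_length_eq[of "UNIV :: bool set" n] by (simp add: words_def)

text \<open>The parity flips: list index \<open>i\<close> is position \<open>i + 1\<close>, so
  Alice's even positions are the odd indices.\<close>

lemma nth_SplitId:
  assumes "i < n"
  shows "SplitId n x y ! i = (if odd i then x ! i else y ! i)"
  using assms by (auto simp: SplitId_def even_iff_mod_2_eq_zero[symmetric] simp del: upt_Suc)

section \<open>Counting inputs compatible with a fixed answer\<close>

lemma card_le_words:
  fixes g :: "'c \<Rightarrow> bool list"
  assumes "inj_on g S" "\<And>z. z \<in> S \<Longrightarrow> length (g z) = m"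
  shows "card S \<le> 2 ^ m"
proof -
  have "g ` S \<subseteq> (words m :: bool list set)" using assms(2) by (auto simp: words_def)
  then have "card (g ` S) \<le> 2 ^ m"
    using card_mono[OF finite_bool_words] by (metis card_words)
  then show ?thesis using card_image[OF assms(1)] by simp
qed

text \<open>The answer reveals \<open>y\<close> at even indices, so only its \<open>n div 2\<close>
  bits at odd indices are free. The bound is rounded up to agree with the one for
  \<open>x\<close>.\<close>

lemma card_SplitId_fiber_right: "card {y \<in> words n. SplitId n x y = s} \<le> 2 ^ ((n + 1) div 2)"
proof -
  let ?g = "\<lambda>y :: bool list. map (\<lambda>j. y ! (2 * j + 1)) [0..<n div 2]"
  have "inj_on ?g {y \<in> words n. SplitId n x y = s}"
  proof (rule inj_onI, clarify)
    fix y y' assume y: "y \<in> words n" "y' \<in> words n" "?g y = ?g y'"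
      and eq: "SplitId n x y' = SplitId n x y"
    show "y = y'"
    proof (rule nth_equalityI)
      show "length y = length y'" using y by (simp add: words_def)
      fix i assume "i < length y"
      then have i: "i < n" using y by (simp add: words_def)
      show "y ! i = y' ! i"
      proof (cases "odd i")
        case True
        then obtain j where j: "i = 2 * j + 1" by (rule oddE)
        with i have "j < n div 2" by simp
        with y(3) j show ?thesis by simp
      next
        case False
        with i eq show ?thesis by (metis nth_SplitId)
      qed
    qed
  qed
  then have "card {y \<in> words n. SplitId n x y = s} \<le> 2 ^ (n div 2)"
    by (rule card_le_words) simp
  also have "\<dots> \<le> 2 ^ ((n + 1) div 2)" by (rule power_increasing) auto
  finally show ?thesis .
qed

lemma card_SplitId_fiber_left: "card {x \<in> words n. SplitId n x y = s} \<le> 2 ^ ((n + 1) div 2)"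
proof -
  let ?g = "\<lambda>x :: bool list. map (\<lambda>j. x ! (2 * j)) [0..<(n + 1) div 2]"
  have "inj_on ?g {x \<in> words n. SplitId n x y = s}"
  proof (rule inj_onI, clarify)
    fix x x' assume x: "x \<in> words n" "x' \<in> words n" "?g x = ?g x'"
      and eq: "SplitId n x' y = SplitId n x y"
    show "x = x'"
    proof (rule nth_equalityI)
      show "length x = length x'" using x by (simp add: words_def)
      fix i assume "i < length x"
      then have i: "i < n" using x by (simp add: words_def)
      show "x ! i = x' ! i"
      proof (cases "even i")
        case True
        then obtain j where j: "i = 2 * j" by (rule evenE)
        with i have "j < (n + 1) div 2" by simp
        with x(3) j show ?thesis by simp
      next
        case False
        with i eq show ?thesis by (metis nth_SplitId)
      qed
    qed
  qed
  then show ?thesis by (rule card_le_words) simp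
qed

section \<open>Counting correctly answered pairs for fixed coins\<close>

lemma card_bool_lists_le: "card {t :: bool list. length t \<le> c} \<le> 2 ^ (c + 1)"
proof -
  have "card {t :: bool list. length t \<le> c} = (\<Sum>i\<le>c. 2 ^ i)"
    using card_lists_length_le[of "UNIV :: bool set" c] by simp
  also have "\<dots> \<le> 2 ^ (c + 1)"
    by (induction c) auto
  finally show ?thesis .
qed

text \<open>The transcript depends on both inputs; allowing every \<open>t\<close> in
  \<open>T\<close> removes this dependence. For fixed \<open>a\<close> and \<open>t\<close> there is
  a single guess, correct for at most \<open>M\<close> values of \<open>b\<close>.\<close>

lemma card_guesses:
  fixes G :: "'t \<Rightarrow> 'a \<Rightarrow> 's option" and F :: "'a \<Rightarrow> 'b \<Rightarrow> 's"
  assumes "finite A" "finite B" "finite T" and fib: "\<And>a s. card {b \<in> B. F a b = s} \<le> M"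
  shows "card {(a, b) \<in> A \<times> B. \<exists>t\<in>T. G t a = Some (F a b)} \<le> card A * card T * M"
proof -
  have "{(a, b) \<in> A \<times> B. \<exists>t\<in>T. G t a = Some (F a b)}
      \<subseteq> (\<Union>(a, t)\<in>A \<times> T. Pair a ` {b \<in> B. F a b = the (G t a)})"
    by force
  then have "card {(a, b) \<in> A \<times> B. \<exists>t\<in>T. G t a = Some (F a b)}
      \<le> card (\<Union>(a, t)\<in>A \<times> T. Pair a ` {b \<in> B. F a b = the (G t a)})"
    using assms by (intro card_mono) auto
  also have "\<dots> \<le> (\<Sum>p\<in>A \<times> T. card (case p of (a, t) \<Rightarrow> Pair a ` {b \<in> B. F a b = the (G t a)}))"
    using assms by (intro card_UN_le) auto
  also have "\<dots> \<le> (\<Sum>p\<in>A \<times> T. M)"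
    using fib by (intro sum_mono) (auto simp: card_image inj_on_def)
  finally show ?thesis by (simp add: card_cartesian_product)
qed

lemma card_correct_pairs:
  assumes "\<And>x y. x \<in> words n \<Longrightarrow> y \<in> words n \<Longrightarrow> length (run \<pi> x y \<omega>) \<le> c"
  shows "card {(x, y) \<in> words n \<times> words n. outputs \<pi> OA OB x y \<omega> \<in>
      {(Some (SplitId n x y), None), (None, Some (SplitId n x y))}}
    \<le> 2 ^ (n + c + 2 + (n + 1) div 2)"
proof -
  obtain r rA rB where \<omega>: "\<omega> = (r, rA, rB)" by (cases \<omega>)
  let ?W = "words n :: bool list set" and ?T = "{t :: bool list. length t \<le> c}"
  \<comment> \<open>Exponents: \<open>n\<close> for the player's own input, \<open>c + 1\<close> for
    the transcripts, \<open>(n + 1) div 2\<close> for the fiber. Adding the two players' counts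
    doubles this.\<close>
  let ?K = "2 ^ (n + c + 1 + (n + 1) div 2) :: nat"
  let ?SA = "{(x, y) \<in> ?W \<times> ?W. \<exists>t\<in>?T. OA t r rA x = Some (SplitId n x y)}"
  \<comment> \<open>Bob's input comes first, so that \<open>card_guesses\<close> applies with the
    roles exchanged; \<open>prod.swap\<close> undoes this below.\<close>
  let ?SB = "{(y, x) \<in> ?W \<times> ?W. \<exists>t\<in>?T. OB t r rB y = Some (SplitId n x y)}"
  have finT: "finite ?T"
    using finite_lists_length_le[of "UNIV :: bool set" c] by simp
  have K: "card ?W * card ?T * 2 ^ ((n + 1) div 2) \<le> ?K"
    using card_bool_lists_le[of c] by (simp add: card_words power_add)
  have A: "card ?SA \<le> ?K"
    using card_guesses[OF finite_bool_words finite_bool_words finT card_SplitId_fiber_right] K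
    by (rule order.trans)
  have B: "card ?SB \<le> ?K"
    using card_guesses[OF finite_bool_words finite_bool_words finT,
        where F = "\<lambda>y x. SplitId n x y", OF card_SplitId_fiber_left] K
    by (rule order.trans)
  have fin: "finite ?SA" "finite ?SB"
    using finite_bool_words[of n] by (auto intro: finite_subset[of _ "?W \<times> ?W"])
  have "{(x, y) \<in> ?W \<times> ?W. outputs \<pi> OA OB x y \<omega> \<in>
      {(Some (SplitId n x y), None), (None, Some (SplitId n x y))}} \<subseteq> ?SA \<union> prod.swap ` ?SB"
    (is "?S \<subseteq> _")
  proof
    fix z assume "z \<in> ?S"
    then obtain x y where z: "z = (x, y)" and xy: "x \<in> ?W" "y \<in> ?W"
      and ok: "outputs \<pi> OA OB x y \<omega> \<in> {(Some (SplitId n x y), None), (None, Some (SplitId n x y))}"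
      by blast
    have t: "run \<pi> x y \<omega> \<in> ?T" using assms xy by simp
    show "z \<in> ?SA \<union> prod.swap ` ?SB"
    proof (cases "OA (run \<pi> x y \<omega>) r rA x = Some (SplitId n x y)")
      case True
      with xy t have "(x, y) \<in> ?SA" by blast
      then show ?thesis unfolding z by (rule UnI1)
    next
      case False
      with ok have "OB (run \<pi> x y \<omega>) r rB y = Some (SplitId n x y)"
        by (auto simp: outputs_def \<omega>)
      with xy t have "(y, x) \<in> ?SB" by blast
      then show ?thesis unfolding z by (intro UnI2 image_eqI[of _ _ "(y, x)"]) simp_all
    qed
  qed
  then have "card ?S \<le> card (?SA \<union> prod.swap ` ?SB)"
    using fin by (intro card_mono) auto
  also have "\<dots> \<le> card ?SA + card ?SB"
    using card_Un_le[of ?SA "prod.swap ` ?SB"] card_image_le[OF fin(2), of prod.swap] by linarith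
  also have "\<dots> \<le> ?K + ?K" using A B by (rule add_mono)
  also have "\<dots> = 2 ^ (n + c + 2 + (n + 1) div 2)" by (simp add: power_add)
  finally show ?thesis .
qed

section \<open>Averaging over the coins\<close>

text \<open>By linearity of expectation the left side is the expected number of successful
  \<open>z\<close>, and that number is at most \<open>K\<close> for every outcome in the
  support.\<close>

lemma sum_prob_le:
  assumes "finite S" and "\<And>\<omega>. \<omega> \<in> set_pmf p \<Longrightarrow> card {z \<in> S. P z \<omega>} \<le> K"
  shows "(\<Sum>z\<in>S. measure_pmf.prob p {\<omega>. P z \<omega>}) \<le> real K"
proof -
  have int: "integrable (measure_pmf p) (indicat_real {\<omega>. P z \<omega>})" for z
    by (rule measure_pmf.integrable_const_bound[where B = 1]) auto
  have "(\<Sum>z\<in>S. measure_pmf.prob p {\<omega>. P z \<omega>})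
      = measure_pmf.expectation p (\<lambda>\<omega>. \<Sum>z\<in>S. indicat_real {\<omega>. P z \<omega>} \<omega>)"
    using int by simp
  also have "\<dots> \<le> real K"
  proof (rule measure_pmf.integral_le_const)
    show "integrable (measure_pmf p) (\<lambda>\<omega>. \<Sum>z\<in>S. indicat_real {\<omega>. P z \<omega>} \<omega>)"
      using int by (intro Bochner_Integration.integrable_sum)
    have "(\<Sum>z\<in>S. indicat_real {\<omega>. P z \<omega>} \<omega>) = real (card {z \<in> S. P z \<omega>})" for \<omega>
      using assms(1) by (simp add: indicator_def sum.If_cases Int_def)
    then show "AE \<omega> in measure_pmf p. (\<Sum>z\<in>S. indicat_real {\<omega>. P z \<omega>} \<omega>) \<le> real K"
      using assms(2) by (auto simp: AE_measure_pmf_iff)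
  qed
  finally show ?thesis .
qed

lemma R_oot_SplitId_lower:
  assumes "\<epsilon> \<le> 1 / 2" "R_oot \<epsilon> n (words n) (words n) (SplitId n) = enat c"
  shows "n \<le> 2 * c + 7"
proof -
  let ?W = "words n :: bool list set"
  let ?K = "2 ^ (n + c + 2 + (n + 1) div 2) :: nat"
  obtain \<pi> where \<pi>: "computes_oot \<epsilon> n ?W ?W (SplitId n) \<pi>" and c: "cost ?W ?W \<pi> = enat c"
    using assms(2) unfolding R_oot_def by (elim INF_enat_attained) simp
  obtain OA OB where succ: "\<And>x y. x \<in> ?W \<Longrightarrow> y \<in> ?W \<Longrightarrow> measure_pmf.prob (coins \<pi>)
        {\<omega>. outputs \<pi> OA OB x y \<omega> \<in>
          {(Some (SplitId n x y), None), (None, Some (SplitId n x y))}} \<ge> 1 - \<epsilon>"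
    using \<pi> unfolding computes_oot_def by blast
  have len: "length (run \<pi> x y \<omega>) \<le> c"
    if "x \<in> ?W" "y \<in> ?W" "\<omega> \<in> set_pmf (coins \<pi>)" for x y \<omega>
  proof -
    have "enat (length (run \<pi> x y \<omega>)) \<le> cost ?W ?W \<pi>"
      unfolding cost_def by (rule SUP_upper2[of "(x, y, \<omega>)"]) (use that in auto)
    then show ?thesis by (simp add: c)
  qed
  let ?P = "\<lambda>(x, y) \<omega>. outputs \<pi> OA OB x y \<omega> \<in>
      {(Some (SplitId n x y), None), (None, Some (SplitId n x y))}"
  \<comment> \<open>Each of the \<open>4 ^ n\<close> input pairs succeeds with probability at least
    \<open>1 - \<epsilon> \<ge> 1 / 2\<close>.\<close>
  have "2 ^ (2 * n) * (1 / 2 :: real) = (\<Sum>z\<in>?W \<times> ?W. 1 / 2)"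
    by (simp add: card_cartesian_product card_words mult_2 power_add)
  also have "\<dots> \<le> (\<Sum>z\<in>?W \<times> ?W. measure_pmf.prob (coins \<pi>) {\<omega>. ?P z \<omega>})"
  proof (rule sum_mono)
    fix z assume "z \<in> ?W \<times> ?W"
    then obtain x y where z: "z = (x, y)" "x \<in> ?W" "y \<in> ?W" by blast
    show "1 / 2 \<le> measure_pmf.prob (coins \<pi>) {\<omega>. ?P z \<omega>}"
      using succ[OF z(2,3)] assms(1) z(1) by simp
  qed
  also have "\<dots> \<le> real ?K"
  proof (rule sum_prob_le)
    show "finite (?W \<times> ?W)" using finite_bool_words by blast
    fix \<omega> assume "\<omega> \<in> set_pmf (coins \<pi>)"
    then have "card {(x, y) \<in> ?W \<times> ?W. ?P (x, y) \<omega>} \<le> ?K"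
      using card_correct_pairs[of n \<pi> \<omega> c OA OB] len by simp
    moreover have "{z \<in> ?W \<times> ?W. ?P z \<omega>} = {(x, y) \<in> ?W \<times> ?W. ?P (x, y) \<omega>}" by auto
    ultimately show "card {z \<in> ?W \<times> ?W. ?P z \<omega>} \<le> ?K" by (simp only:)
  qed
  finally have "(2 :: real) ^ (2 * n) \<le> 2 ^ Suc (n + c + 2 + (n + 1) div 2)" by simp
  then have "2 * n \<le> Suc (n + c + 2 + (n + 1) div 2)"
    by (subst (asm) power_increasing_iff) auto
  then show ?thesis by linarith
qed

lemma R_oot_SplitId_bigomega:
  assumes "0 \<le> \<epsilon>" "\<epsilon> \<le> 1 / 2"
  shows "(\<lambda>n. real (the_enat (R_oot \<epsilon> n (words n) (words n) (SplitId n)))) \<in> \<Omega>(\<lambda>n. real n)"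
proof (rule landau_omega.bigI[of "1 / 4"])
  show "\<forall>\<^sub>F n in at_top. norm (real (the_enat (R_oot \<epsilon> n (words n) (words n) (SplitId n))))
      \<ge> 1 / 4 * norm (real n)"
    \<comment> \<open>From \<open>n \<le> 2 * c + 7\<close> follows
      \<open>c \<ge> (n - 7) / 2\<close>, which is at least \<open>n / 4\<close> exactly when
      \<open>n \<ge> 14\<close>.\<close>
    using eventually_ge_at_top[of 14]
  proof eventually_elim
    case (elim n)
    \<comment> \<open>Finiteness makes \<open>the_enat\<close> return the true cost.\<close>
    have "R_oot \<epsilon> n (words n) (words n) (SplitId n) < \<infinity>"
      using R_oot_finite[OF finite_bool_words assms(1) SplitId_words] .
    then obtain c where c: "R_oot \<epsilon> n (words n) (words n) (SplitId n) = enat c" by auto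
    with R_oot_SplitId_lower[OF assms(2) c] elim show ?case by simp
  qed
qed simp

theorem mainTheorem12:
  fixes \<epsilon> :: real
  assumes "0 < \<epsilon>" and "\<epsilon> < 1 / 2"
  shows "(\<forall>k (X :: 'x set) (Y :: 'y set) f. (\<forall>x\<in>X. \<forall>y\<in>Y. f x y \<in> words k) \<longrightarrow>
            R_spt \<epsilon> k X Y f \<le> R_oot \<epsilon> k X Y f \<and>
            R_oot \<epsilon> k X Y f \<le> R_spt \<epsilon> k X Y f + enat (k div 2 + 1))
       \<and> (\<lambda>n. real (the_enat (D_spt n (words n) (words n) (SplitId n)))) \<in> O(\<lambda>n. 1)
       \<and> (\<lambda>n. real (the_enat (R_oot \<epsilon> n (words n) (words n) (SplitId n)))) \<in> \<Omega>(\<lambda>n. real n)"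
proof (intro conjI allI impI)
  show "(\<lambda>n. real (the_enat (D_spt n (words n) (words n) (SplitId n)))) \<in> O(\<lambda>n. 1)"
    by (simp add: D_spt_SplitId zero_enat_def)
  show "(\<lambda>n. real (the_enat (R_oot \<epsilon> n (words n) (words n) (SplitId n)))) \<in> \<Omega>(\<lambda>n. real n)"
    using assms by (intro R_oot_SplitId_bigomega) auto
qed (rule R_spt_le_R_oot, blast, rule R_oot_le_R_spt)

end
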